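(* Let $\varepsilon>0$ and let $K^1,\dots,K^m$ ($m>n$) be bodies in $\mathbb{E}^n$ of class $\mathcal{K}^\varepsilon_3$ with diameters $d_{K^i}\le d<1/(2\varepsilon)$ for all $i\le m$. Suppose that for any $K^{i_1},\dots,K^{i_{n+1}}$ of this family there is $x'\in\mathbb{E}^n$ such that $\mathrm{dist}(x',K^{i_j})\le\varepsilon'$ for all $j\le n+1$ ($\varepsilon'=0$ if their intersection is non-empty). Then $$\mathrm{dist}(x,K^i)\le\varepsilon'+\varepsilon\,(m-n-1)\,d^2/2$$ for some $x\in\mathbb{E}^n$ and all $i\le m$.
   Context: $\mathbb{E}^n$ is $n$-dimensional Euclidean space, $B(C,r)=\{x:\|x-C\|\le r\}$ is the closed ball of radius $r$ centered at $C$, $\mathrm{dist}(x,K)=\inf_{y\in K}\|x-y\|$, and $d_K=\max\{\|x-y\|:x,y\in K\}$ is the diameter. Bodies are understood to be compact (a convex body being a compact convex set with non-empty interior); $\mathrm{int}\,K$ is the interior of $K$ and $\partial K=K\setminus\mathrm{int}\,K$ its boundary. A ball is called an outer support ball of a body $K$ if it does not intersect $\mathrm{int}\,K$ and intersects $K$ at its boundary points. A body $K$ belongs to $\mathcal{K}^\varepsilon_3$ if any outer support ball $B(x,r)$ of $K$ with $r<1/\varepsilon$ is contained in an outer support ball of $K$ of radius $1/\varepsilon$. *)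

theory Defs
  imports "HOL-Analysis.Analysis"
begin

definition body :: "'a::euclidean_space set \<Rightarrow> bool" where
  "body K \<longleftrightarrow> compact K \<and> K \<noteq> {}"

text \<open>
  The ball \<open>cball c r\<close> avoids the interior of \<open>K\<close>, meets \<open>K\<close>, and does so only at points of
  its own bounding sphere; these points then lie in \<open>K - interior K\<close> as well. When \<open>K\<close> is the
  closure of its interior, the sphere condition is automatic, see
  \<open>outer_support_ball_regular\<close> below. For other compact sets it is essential: without it
  every ball touching a finite set would be an outer support ball.
\<close>

definition outer_support_ball :: "'a::euclidean_space set \<Rightarrow> 'a \<Rightarrow> real \<Rightarrow> bool" where
  "outer_support_ball K c r \<longleftrightarrow>
     0 < r \<and> cball c r \<inter> interior K = {} \<and>
     cball c r \<inter> K \<noteq> {} \<and> cball c r \<inter> K \<subseteq> sphere c r"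

definition K3_class :: "real \<Rightarrow> 'a::euclidean_space set set" where
  "K3_class \<epsilon> = {K. body K \<and>
     (\<forall>x r. outer_support_ball K x r \<and> r < 1 / \<epsilon> \<longrightarrow>
        (\<exists>c. outer_support_ball K c (1 / \<epsilon>) \<and> cball x r \<subseteq> cball c (1 / \<epsilon>)))}"

lemma outer_support_ball_regular:
  fixes K :: "'a::euclidean_space set"
  assumes "closure (interior K) = K" and "0 < r"
  shows "outer_support_ball K c r \<longleftrightarrow>
    cball c r \<inter> interior K = {} \<and> cball c r \<inter> (K - interior K) \<noteq> {}"
proof -
  have "cball c r \<inter> K \<subseteq> sphere c r" if "cball c r \<inter> interior K = {}"
  proof -
    have "ball c r \<inter> interior K = {}"
      using that ball_subset_cball by blast
    then have "ball c r \<inter> K = {}"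
      using open_Int_closure_eq_empty[of "ball c r" "interior K"] assms(1) by simp
    then show ?thesis
      by (auto simp: disjoint_iff) (metis order_le_less)
  qed
  then show ?thesis
    using assms(2) unfolding outer_support_ball_def by blast
qed

end

theory Submission imports Defs begin

text \<open>
  The class \<open>K3_class \<epsilon>\<close> consists of sets that are convex up to a second order error. If \<open>y\<close> is
  the point of \<open>K\<close> nearest to a point \<open>x\<close> and \<open>dist x y < 1 / \<epsilon>\<close>, the ball about \<open>x\<close> through
  \<open>y\<close> supports \<open>K\<close> from outside. The ball of radius \<open>1 / \<epsilon>\<close> that the class provides around it
  is tangent to it at \<open>y\<close> and has no point of \<open>K\<close> inside, so \<open>K\<close> can rise above the tangent
  hyperplane at \<open>y\<close> by at most \<open>\<epsilon> * (dist z y)\<^sup>2 / 2\<close> at the point \<open>z\<close>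
  (\<open>K3_class_almost_supporting\<close>). For a convex set the rise would be \<open>0\<close>.

  A point \<open>p\<close> of the convex hull of \<open>K\<close> lies in every half-space that contains \<open>K\<close>; applied to
  the half-space at the point of \<open>K\<close> nearest to \<open>p\<close>, this gives \<open>infdist p K \<le> \<epsilon> * d\<^sup>2 / 2\<close> (\<open>K3_class_infdist_convex_hull\<close>). So replacing
  each body by its convex hull costs only \<open>\<epsilon> * d\<^sup>2 / 2\<close>, whatever the number of bodies. Helly's
  theorem applied to the closed \<open>\<epsilon>'\<close>-neighbourhoods of the hulls yields a point \<open>x\<close> at distance
  at most \<open>\<epsilon>'\<close> from all hulls, hence at most \<open>\<epsilon>' + \<epsilon> * d\<^sup>2 / 2\<close> from all bodies. This is within
  the required bound as soon as \<open>m \<ge> DIM('a) + 2\<close>; for \<open>m = DIM('a) + 1\<close> the hypothesis speaks of the whole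
  family already.
\<close>

text \<open>
  Equality in the triangle inequality: the centre of a ball that is tangent from inside lies on
  the radius of the larger ball to the common boundary point.
\<close>

lemma internally_tangent_balls_centre:
  fixes x c y :: "'a::euclidean_space"
  assumes "cball x r \<subseteq> cball c R" and "dist x y = r" and "dist c y = R"
  shows "r *\<^sub>R (c - y) = R *\<^sub>R (x - y)"
proof -
  have "0 \<le> r"
    using assms(2) zero_le_dist by metis
  then have "dist x c + r \<le> R"
    using assms(1) by (simp add: cball_subset_cball_iff)
  moreover have "R \<le> dist x c + r"
    using dist_triangle[of c y x] assms(2,3) by (simp add: dist_commute)
  ultimately have cx: "norm (c - x) = R - r"
    by (simp add: dist_norm norm_minus_commute)
  have xy: "norm (x - y) = r"
    using assms(2) by (simp add: dist_norm)
  have "norm ((c - x) + (x - y)) = norm (c - x) + norm (x - y)"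
    using assms(3) by (simp add: cx xy dist_norm)
  then have "(R - r) *\<^sub>R (x - y) = r *\<^sub>R (c - x)"
    using cx xy norm_triangle_eq[of "c - x" "x - y"] by simp
  then show ?thesis
    by (simp add: algebra_simps)
qed

text \<open>
  A point \<open>z\<close> outside the open ball of radius \<open>1 / \<epsilon>\<close> tangent at \<open>y\<close> exceeds the tangent
  hyperplane by a quadratic amount only. The estimate is multiplied by \<open>dist x y\<close> so that it
  makes sense, and is trivial, when \<open>x = y\<close>.
\<close>

lemma K3_class_almost_supporting:
  fixes K :: "'a::euclidean_space set"
  assumes "0 < \<epsilon>" and K: "K \<in> K3_class \<epsilon>"
    and y: "y \<in> K" "infdist x K = dist x y" and near: "dist x y < 1 / \<epsilon>"
    and z: "z \<in> K"
  shows "(x - y) \<bullet> (z - y) \<le> \<epsilon> / 2 * dist x y * (dist z y)\<^sup>2"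
proof (cases "x = y")
  case True
  then show ?thesis by simp
next
  case False
  define r where "r = dist x y"
  have r: "0 < r"
    using False by (simp add: r_def)
  have on_sphere: "cball x r \<inter> K \<subseteq> sphere x r"
    using infdist_le[of _ K x] y(2) by (fastforce simp: r_def)
  have "cball x r \<inter> interior K = {}"
  proof -
    have "ball x r \<inter> interior K = {}"
      using on_sphere interior_subset[of K] by (force simp: disjoint_iff subset_iff)
    then show ?thesis
      using open_Int_closure_eq_empty[of "interior K" "ball x r"] r
      by (simp add: Int_commute)
  qed
  then have "outer_support_ball K x r"
    using r on_sphere y(1) unfolding outer_support_ball_def r_def by fastforce
  then obtain c where c: "outer_support_ball K c (1 / \<epsilon>)" "cball x r \<subseteq> cball c (1 / \<epsilon>)"
    using K near unfolding K3_class_def r_def by blast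
  have "y \<in> cball c (1 / \<epsilon>)"
    using c(2) r_def by auto
  then have cy: "dist c y = 1 / \<epsilon>"
    using c(1) y(1) unfolding outer_support_ball_def by auto
  have "1 / \<epsilon> \<le> dist c z"
    using c(1) z unfolding outer_support_ball_def
    by (cases "z \<in> cball c (1 / \<epsilon>)") auto
  then have "(dist c y)\<^sup>2 \<le> (dist c z)\<^sup>2"
    unfolding cy[symmetric] by (rule power_mono) simp
  also have "(dist c z)\<^sup>2 = (dist c y)\<^sup>2 - 2 * ((c - y) \<bullet> (z - y)) + (dist z y)\<^sup>2"
    by (simp add: dist_norm power2_norm_eq_inner algebra_simps inner_commute)
  finally have "2 * ((c - y) \<bullet> (z - y)) \<le> (dist z y)\<^sup>2"
    by simp
  then have "r * (2 * ((c - y) \<bullet> (z - y))) \<le> r * (dist z y)\<^sup>2"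
    using r by (simp add: mult_left_mono)
  moreover have "r * ((c - y) \<bullet> (z - y)) = (1 / \<epsilon>) * ((x - y) \<bullet> (z - y))"
    using internally_tangent_balls_centre[OF c(2) r_def[symmetric] cy]
    by (metis inner_scaleR_left)
  ultimately have "2 * ((x - y) \<bullet> (z - y)) / \<epsilon> \<le> r * (dist z y)\<^sup>2"
    by (simp add: mult.left_commute)
  then show ?thesis
    using \<open>0 < \<epsilon>\<close> by (simp add: r_def field_simps)
qed

text \<open>
  The half-space that almost supports \<open>K\<close> at the point nearest to \<open>p\<close> is convex and contains
  \<open>K\<close>, hence it contains \<open>p\<close>; reading off the height of \<open>p\<close> bounds its distance from \<open>K\<close>.
\<close>

lemma K3_class_infdist_convex_hull:
  fixes K :: "'a::euclidean_space set"
  assumes "0 < \<epsilon>" and K: "K \<in> K3_class \<epsilon>"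
    and diam: "diameter K \<le> d" "d < 1 / \<epsilon>"
    and p: "p \<in> convex hull K"
  shows "infdist p K \<le> \<epsilon> * d\<^sup>2 / 2"
proof -
  have "compact K" "K \<noteq> {}"
    using K by (auto simp: K3_class_def body_def)
  then obtain y where y: "y \<in> K" "infdist p K = dist p y"
    using infdist_attains_inf compact_imp_closed by metis
  have le_d: "dist z y \<le> d" if "z \<in> K" for z
    using diameter_bounded_bound[OF compact_imp_bounded[OF \<open>compact K\<close>] that y(1)] diam(1)
    by simp
  \<comment> \<open>The support condition is available only at points closer to \<open>K\<close> than \<open>1 / \<epsilon>\<close>; the hull
    is close enough because a ball of radius \<open>d\<close> about a point of \<open>K\<close> contains it.\<close>
  have "convex hull K \<subseteq> cball y d"
    by (rule hull_minimal) (use le_d in \<open>auto simp: dist_commute\<close>)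
  then have "dist p y < 1 / \<epsilon>"
    using p diam(2) by (auto simp: dist_commute)
  then have rise: "(p - y) \<bullet> z \<le> (p - y) \<bullet> y + \<epsilon> / 2 * dist p y * d\<^sup>2" if "z \<in> K" for z
  proof -
    have "(p - y) \<bullet> (z - y) \<le> \<epsilon> / 2 * dist p y * (dist z y)\<^sup>2"
      using K3_class_almost_supporting[OF \<open>0 < \<epsilon>\<close> K y \<open>dist p y < 1 / \<epsilon>\<close> that] .
    also have "\<dots> \<le> \<epsilon> / 2 * dist p y * d\<^sup>2"
      using le_d[OF that] \<open>0 < \<epsilon>\<close> by (intro mult_left_mono power_mono) auto
    finally show ?thesis
      by (simp add: inner_diff_right)
  qed
  have "convex hull K \<subseteq> {z. (p - y) \<bullet> z \<le> (p - y) \<bullet> y + \<epsilon> / 2 * dist p y * d\<^sup>2}"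
    by (rule hull_minimal) (use rise in \<open>auto simp: convex_halfspace_le\<close>)
  then have "(p - y) \<bullet> (p - y) \<le> \<epsilon> / 2 * dist p y * d\<^sup>2"
    using p by (auto simp: inner_diff_right)
  then have "dist p y * dist p y \<le> dist p y * (\<epsilon> * d\<^sup>2 / 2)"
    by (simp add: dist_norm power2_norm_eq_inner[symmetric] power2_eq_square mult_ac)
  then have "dist p y \<le> \<epsilon> * d\<^sup>2 / 2"
    using \<open>0 < \<epsilon>\<close> by (cases "dist p y = 0") (auto simp: mult_le_cancel_left)
  then show ?thesis
    using y(2) by simp
qed

text \<open>
  Helly's theorem for indexed families. Repetitions may leave fewer than \<open>DIM('a) + 1\<close>
  different sets, too few for the theorem about sets of sets; then some
  \<open>DIM('a) + 1\<close> indices already produce all of them.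
\<close>

lemma helly_indexed:
  fixes C :: "'i \<Rightarrow> 'a::euclidean_space set"
  assumes "finite J" and card: "DIM('a) + 1 \<le> card J"
    and convex: "\<And>j. j \<in> J \<Longrightarrow> convex (C j)"
    and meet: "\<And>I. I \<subseteq> J \<Longrightarrow> card I = DIM('a) + 1 \<Longrightarrow> (\<Inter>i\<in>I. C i) \<noteq> {}"
  shows "(\<Inter>j\<in>J. C j) \<noteq> {}"
proof -
  have small: "\<Inter>T \<noteq> {}" if T: "T \<subseteq> C ` J" "card T \<le> DIM('a) + 1" for T
  proof -
    obtain I0 where I0: "I0 \<subseteq> J" "inj_on C I0" "T = C ` I0"
      using T(1) by (metis subset_image_inj)
    have "card I0 \<le> DIM('a) + 1"
      using T(2) I0 by (simp add: card_image)
    then obtain I where "I0 \<subseteq> I" "I \<subseteq> J" "card I = DIM('a) + 1"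
      using exists_subset_between[OF _ card I0(1) \<open>finite J\<close>] by blast
    then show ?thesis
      using meet[of I] I0(3) by blast
  qed
  show ?thesis
  proof (cases "DIM('a) + 1 \<le> card (C ` J)")
    case True
    show ?thesis
      by (rule Helly[OF True]) (use convex small in auto)
  next
    case False
    then show ?thesis
      using small[of "C ` J"] by simp
  qed
qed

theorem theorem3:
  fixes K :: "nat \<Rightarrow> 'a::euclidean_space set"
    and \<epsilon> \<epsilon>' d :: real and m :: nat
  assumes "\<epsilon> > 0"
    and "m > DIM('a)"
    and "\<And>i. i \<in> {1..m} \<Longrightarrow> K i \<in> K3_class \<epsilon>"
    and "\<And>i. i \<in> {1..m} \<Longrightarrow> diameter (K i) \<le> d"
    and "d < 1 / (2 * \<epsilon>)"
    and "\<And>I. I \<subseteq> {1..m} \<Longrightarrow> card I = DIM('a) + 1 \<Longrightarrow>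
           \<exists>x'. \<forall>j\<in>I. infdist x' (K j) \<le> \<epsilon>'"
  shows "\<exists>x. \<forall>i\<in>{1..m}.
           infdist x (K i) \<le> \<epsilon>' + \<epsilon> * (real m - real DIM('a) - 1) * d\<^sup>2 / 2"
proof (cases "m = DIM('a) + 1")
  case True
  then show ?thesis
    using assms(6)[of "{1..m}"] by simp
next
  case False
  \<comment> \<open>Written as a Minkowski sum, the neighbourhood of the hull is visibly convex.\<close>
  define C where "C i = (\<Union>p\<in>convex hull K i. \<Union>v\<in>cball 0 \<epsilon>'. {p + v})" for i
  have d: "d < 1 / \<epsilon>"
  proof -
    have "1 / (2 * \<epsilon>) < 1 / \<epsilon>"
      using \<open>\<epsilon> > 0\<close> by (simp add: field_simps)
    then show ?thesis
      using assms(5) by linarith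
  qed
  have "(\<Inter>i\<in>{1..m}. C i) \<noteq> {}"
  proof (rule helly_indexed)
    show "convex (C i)" for i
      unfolding C_def by (intro convex_sums convex_convex_hull convex_cball)
    show "(\<Inter>i\<in>I. C i) \<noteq> {}" if I: "I \<subseteq> {1..m}" "card I = DIM('a) + 1" for I
    proof -
      obtain x' where x': "\<forall>j\<in>I. infdist x' (K j) \<le> \<epsilon>'"
        using assms(6)[OF I] by blast
      have "x' \<in> C i" if "i \<in> I" for i
      proof -
        have "closed (K i)" "K i \<noteq> {}"
          using assms(3)[of i] that I(1) by (auto simp: K3_class_def body_def compact_imp_closed)
        then obtain y where "y \<in> K i" "infdist x' (K i) = dist x' y"
          using infdist_attains_inf by metis
        then have "y \<in> convex hull K i" "x' - y \<in> cball 0 \<epsilon>'" "x' = y + (x' - y)"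
          using x' that by (auto simp: hull_inc dist_norm norm_minus_commute)
        then show ?thesis
          unfolding C_def by blast
      qed
      then show ?thesis by blast
    qed
  qed (use assms(2) in auto)
  then obtain x where x: "x \<in> C i" if "i \<in> {1..m}" for i
    by blast
  have "infdist x (K i) \<le> \<epsilon>' + \<epsilon> * (real m - real DIM('a) - 1) * d\<^sup>2 / 2"
    if i: "i \<in> {1..m}" for i
  proof -
    obtain p where p: "p \<in> convex hull K i" "dist x p \<le> \<epsilon>'"
      using x[OF i] by (auto simp: C_def dist_norm)
    have "infdist x (K i) \<le> infdist p (K i) + dist x p"
      by (rule infdist_triangle)
    also have "\<dots> \<le> \<epsilon> * d\<^sup>2 / 2 + \<epsilon>'"
      using K3_class_infdist_convex_hull[OF assms(1) assms(3)[OF i] assms(4)[OF i] d p(1)] p(2)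
      by (rule add_mono)
    finally have "infdist x (K i) \<le> \<epsilon> * d\<^sup>2 / 2 + \<epsilon>'" .
    moreover have "\<epsilon> * d\<^sup>2 / 2 * 1 \<le> \<epsilon> * d\<^sup>2 / 2 * (real m - real DIM('a) - 1)"
      using False assms(1,2) by (intro mult_left_mono) auto
    moreover have "\<epsilon> * d\<^sup>2 / 2 * (real m - real DIM('a) - 1)
        = \<epsilon> * (real m - real DIM('a) - 1) * d\<^sup>2 / 2"
      by simp
    ultimately show ?thesis
      by linarith
  qed
  then show ?thesis by blast
qed

end
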